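(* Assume that for each $k\in\mathbb Z_N$, $$\begin{aligned} f_k(x,u)&=A_kx+B_ku+o(\|(x,u)\|),\\ L_k(x,u)&=\tfrac12\begin{bmatrix}x^{\mathrm T}&u^{\mathrm T}\end{bmatrix}\begin{bmatrix}Q_k&N_k\\N_k^{\mathrm T}&R_k\end{bmatrix}\begin{bmatrix}x\\ u\end{bmatrix}+o(\|(x,u)\|^2),\\ V_f(x)&=\tfrac12x^{\mathrm T}P_fx+o(\|x\|^2),\end{aligned}$$ with $P_f$ positive definite, and assume that the matrices $P_k$ and $R_k+B_k^{\mathrm T}P_{k+1}B_k$ are positive definite for all $k\in\mathbb Z_N$, where $P_N=P_f$ and, for $k\in\mathbb Z_N$, $$\begin{aligned}K_k&=-(R_k+B_k^{\mathrm T}P_{k+1}B_k)^{-1}(B_k^{\mathrm T}P_{k+1}A_k+N_k^{\mathrm T}),\\ P_k&=A_k^{\mathrm T}P_{k+1}A_k+Q_k+(A_k^{\mathrm T}P_{k+1}B_k+N_k)K_k.\end{aligned}$$ Then, for every $k\in\mathbb Z_N$, $$\Delta\tilde V_k(x,\hat u)=\tfrac12\hat u^{\mathrm T}(R_k+B_k^{\mathrm T}P_{k+1}B_k)\hat u+o(\|(x,\hat u)\|^2).$$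
   Context: $N$ is a positive integer and $\mathbb Z_N=\{0,1,\dots,N-1\}$. For each $k\in\mathbb Z_N$, $f_k:\mathbb R^n\times\mathbb R^m\to\mathbb R^n$ is continuous with $f_k(0,0)=0$. The cost functions $V_f:\mathbb R^n\to\mathbb R$ and $L_k:\mathbb R^n\times\mathbb R^m\to\mathbb R$ are continuous and locally bounded and satisfy $L_k(0,0)=V_f(0)=0$, $L_k(x,u)\ge\alpha(\|u\|)$ and $V_f(x)\ge 0$ for all $x\in\mathbb R^n$, $u\in\mathbb R^m$, $k\in\mathbb Z_N$, where $\alpha$ is a $\mathcal K_\infty$-function (i.e., $\alpha:[0,\infty)\to[0,\infty)$ is continuous, strictly increasing, unbounded, with $\alpha(0)=0$). These are the data of the model predictive control problem of minimizing $V_f(x_N)+\sum_{k=0}^{N-1}L_k(x_k,u_k)$ over control sequences subject to $x_{k+1}=f_k(x_k,u_k)$, $(x_k,u_k)\in\mathcal C_k$ for all $k\in\mathbb Z_N$ (with $\mathcal C_k$ closed), and $x_N\in\mathcal X_N$, with $x_0$ given; the constraint sets play no role in the definition of $\Delta\tilde V_k$. The matrices are real with $A_k,Q_k,P_f\in\mathbb R^{n\times n}$, $B_k,N_k\in\mathbb R^{n\times m}$, $R_k\in\mathbb R^{m\times m}$; "positive definite" means symmetric positive definite. The $o(\cdot)$ terms are understood as the arguments tend to $0$. The unconstrained value functions $\tilde V_k:\mathbb R^n\to\mathbb R$ are defined by $\tilde V_N=V_f$ and, for $k\in\mathbb Z_N$, $$\tilde V_k(x)=\min_{u\in\mathbb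 R^m}\ \tilde V_{k+1}(f_k(x,u))+L_k(x,u).$$ For each $k\in\mathbb Z_N$, $\kappa_k:\mathbb R^n\to\mathbb R^m$ is a feedback law selecting, for every $x$, an (arbitrarily chosen) minimizer in this problem, so that $\tilde V_k(x)=\tilde V_{k+1}(f_k(x,\kappa_k(x)))+L_k(x,\kappa_k(x))$. For $k\in\mathbb Z_N$ define $$\hat f_k(x,\hat u)=f_k(x,\kappa_k(x)+\hat u),\qquad \hat L_k(x,\hat u)=L_k(x,\kappa_k(x)+\hat u),$$ $$\Delta\tilde V_k(x,\hat u)=\tilde V_{k+1}(\hat f_k(x,\hat u))+\hat L_k(x,\hat u)-\tilde V_k(x).$$ *)

theory Defs
  imports "HOL-Analysis.Analysis" "HOL-Library.Landau_Symbols"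
begin

definition class_Kinf :: "(real \<Rightarrow> real) \<Rightarrow> bool" where
  "class_Kinf \<alpha> \<longleftrightarrow> \<alpha> ` {0..} \<subseteq> {0..} \<and> continuous_on {0..} \<alpha> \<and> strict_mono_on {0..} \<alpha> \<and>
     \<not> bdd_above (\<alpha> ` {0..}) \<and> \<alpha> 0 = 0"

definition locally_bounded :: "('a::topological_space \<Rightarrow> real) \<Rightarrow> bool" where
  "locally_bounded g \<longleftrightarrow> (\<forall>x. \<exists>U. open U \<and> x \<in> U \<and> bounded (g ` U))"

definition pos_def :: "real^'a^'a \<Rightarrow> bool" where
  "pos_def P \<longleftrightarrow> transpose P = P \<and> (\<forall>x. x \<noteq> 0 \<longrightarrow> x \<bullet> (P *v x) > 0)"

text \<open>The product of the row \<open>[x\<^sup>T u\<^sup>T]\<close>, the block matrix with rows \<open>[Q M]\<close> and \<open>[M\<^sup>T R]\<close>,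
  and the column \<open>[x; u]\<close>, multiplied out blockwise.\<close>

definition block_form ::
  "real^'n^'n \<Rightarrow> real^'m^'n \<Rightarrow> real^'m^'m \<Rightarrow> real^'n \<Rightarrow> real^'m \<Rightarrow> real" where
  "block_form Q M R x u =
     x \<bullet> (Q *v x) + x \<bullet> (M *v u) + u \<bullet> (transpose M *v x) + u \<bullet> (R *v u)"

text \<open>Backward recursion from stage \<open>N\<close>; only the indices \<open>k \<le> N\<close> are meaningful. \<open>LEAST\<close> denotes
  the minimum of the set of achievable costs and is unspecified if no minimum exists.\<close>

function value_fn ::
  "nat \<Rightarrow> (nat \<Rightarrow> 'x \<times> 'u \<Rightarrow> 'x) \<Rightarrow> (nat \<Rightarrow> 'x \<times> 'u \<Rightarrow> real) \<Rightarrow> ('x \<Rightarrow> real) \<Rightarrow> nat \<Rightarrow> 'x \<Rightarrow> real"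
where
  "value_fn N f L Vf k x =
     (if k < N
      then (LEAST c. c \<in> range (\<lambda>u. value_fn N f L Vf (k + 1) (f k (x, u)) + L k (x, u)))
      else Vf x)"
  by pat_completeness auto
termination
  by (relation "Wellfounded.measure (\<lambda>(N, f, L, Vf, k, x). N - k)") auto

declare value_fn.simps [simp del]

definition minimizing_feedback ::
  "nat \<Rightarrow> (nat \<Rightarrow> 'x \<times> 'u \<Rightarrow> 'x) \<Rightarrow> (nat \<Rightarrow> 'x \<times> 'u \<Rightarrow> real) \<Rightarrow> ('x \<Rightarrow> real) \<Rightarrow>
    (nat \<Rightarrow> 'x \<Rightarrow> 'u) \<Rightarrow> bool" where
  "minimizing_feedback N f L Vf \<kappa> \<longleftrightarrow>
     (\<forall>k<N. \<forall>x. is_arg_min (\<lambda>u. value_fn N f L Vf (k + 1) (f k (x, u)) + L k (x, u))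
                          (\<lambda>u. True) (\<kappa> k x))"

definition shift_input :: "('x \<Rightarrow> 'u::plus) \<Rightarrow> ('x \<times> 'u \<Rightarrow> 'y) \<Rightarrow> 'x \<times> 'u \<Rightarrow> 'y" where
  "shift_input \<kappa> g = (\<lambda>(x, v). g (x, \<kappa> x + v))"

definition delta_value ::
  "nat \<Rightarrow> (nat \<Rightarrow> 'x \<times> 'u::plus \<Rightarrow> 'x) \<Rightarrow> (nat \<Rightarrow> 'x \<times> 'u \<Rightarrow> real) \<Rightarrow> ('x \<Rightarrow> real) \<Rightarrow>
    (nat \<Rightarrow> 'x \<Rightarrow> 'u) \<Rightarrow> nat \<Rightarrow> 'x \<times> 'u \<Rightarrow> real" where
  "delta_value N f L Vf \<kappa> k = (\<lambda>(x, v).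
     value_fn N f L Vf (k + 1) (shift_input (\<kappa> k) (f k) (x, v))
       + shift_input (\<kappa> k) (L k) (x, v) - value_fn N f L Vf k x)"

end

theory Submission
  imports Defs
begin

text \<open>
  Write \<open>V\<close> for the value function of stage \<open>k + 1\<close>, \<open>P\<^sup>+\<close> for the matrix \<open>P (k + 1)\<close>, \<open>P\<close>, \<open>K\<close>, \<open>\<kappa>\<close>
  for the data of stage \<open>k\<close>, \<open>F(x, u) = V(f(x, u)) + L(x, u)\<close> for the cost that is minimized at stage
  \<open>k\<close>, and \<open>H = R + B\<^sup>T P\<^sup>+ B\<close>. If \<open>V(x) = 1/2 x\<^sup>T P\<^sup>+ x + o(|x|\<^sup>2)\<close>, then substituting the expansions of
  \<open>f\<close> and \<open>L\<close> (\<open>stage_cost_expansion\<close>) and completing the square (\<open>completion_of_square\<close>) gives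
  \<open>F(x, u) = 1/2 x\<^sup>T P x + 1/2 (u - K x)\<^sup>T H (u - K x) + o(|(x, u)|\<^sup>2)\<close>.

  This expansion is local in \<open>u\<close>, whereas \<open>\<kappa>(x)\<close> is a global minimizer, chosen without any regularity.
  Two comparisons with the competitor \<open>u = K x\<close> locate it (\<open>minimizer_expansion\<close>). First,
  \<open>\<alpha>(|\<kappa>(x)|) \<le> F(x, \<kappa>(x)) \<le> F(x, K x)\<close>, and the right-hand side tends to \<open>0\<close>, so \<open>\<kappa>(x)\<close> tends to \<open>0\<close>
  and the expansion applies along \<open>\<kappa>\<close>. Second, with \<open>w = \<kappa>(x) - K x\<close>, the inequality
  \<open>F(x, \<kappa>(x)) \<le> F(x, K x)\<close> becomes \<open>1/2 w\<^sup>T H w \<le> o(|x|\<^sup>2 + |w|\<^sup>2)\<close>; as \<open>H\<close> is coercive, the \<open>w\<close>-part of the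
  error is absorbed, and \<open>w = o(|x|)\<close>.

  Hence \<open>F(x, \<kappa>(x) + v) = 1/2 x\<^sup>T P x + 1/2 v\<^sup>T H v + o(|(x, v)|\<^sup>2)\<close>, because replacing \<open>v\<close> by \<open>w + v\<close> in the
  quadratic form changes it only by \<open>o(|(x, v)|\<^sup>2)\<close> (\<open>perturbed_minimizer_expansion\<close>). Taking \<open>v = 0\<close>
  yields the expansion of the value function of stage \<open>k\<close>, which carries the backward induction;
  subtracting that expansion leaves the claim.

  All estimates are made along \<open>nhds 0\<close> and not along \<open>at 0\<close>: the expansion of \<open>V\<close> is composed with
  \<open>f\<close>, which tends to \<open>0\<close> but may also take the value \<open>0\<close> away from the origin.
\<close>

section \<open>Landau estimates at a point\<close>

lemma smallo_at_imp_nhds: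
  fixes f g :: "'a::t1_space \<Rightarrow> real"
  assumes "f \<in> o[at a](g)" and "f a = 0"
  shows "f \<in> o[nhds a](g)"
proof (rule landau_o.smallI)
  fix c :: real assume "c > 0"
  from landau_o.smallD[OF assms(1) this] show "\<forall>\<^sub>F x in nhds a. norm (f x) \<le> c * norm (g x)"
    using assms(2) \<open>c > 0\<close> by (simp add: eventually_nhds_conv_at)
qed

lemma smallo_nhds_imp_at: "f \<in> o[nhds a](g) \<Longrightarrow> f \<in> o[at a](g)"
  by (rule landau_o.small.filter_mono[of _ "nhds a"]) (simp_all add: at_within_le_nhds)

lemma isCont_tendsto_nhds: "isCont f a \<Longrightarrow> (f \<longlongrightarrow> f a) (nhds a)"
  by (simp add: isCont_def tendsto_at_iff_tendsto_nhds)

text \<open>The absorption step of the estimate for the minimizer: an error that is small relative to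
  \<open>g + f\<close>, where \<open>f\<close> is the quantity being estimated, can be moved to the left-hand side.\<close>

lemma smallo_self_absorb:
  fixes f g :: "'a \<Rightarrow> real"
  assumes "f \<in> o[F](\<lambda>x. g x + f x)" and "\<And>x. f x \<ge> 0" and "\<And>x. g x \<ge> 0"
  shows "f \<in> o[F](g)"
proof (rule landau_o.smallI)
  fix c :: real assume "c > 0"
  \<comment> \<open>From \<open>f \<le> d g + d f\<close> and \<open>d \<le> 1/2\<close> follows \<open>f \<le> 2 d g\<close>.\<close>
  define d where "d = min (1/2) (c/2)"
  have "d > 0" "d \<le> 1/2" "2 * d \<le> c" using \<open>c > 0\<close> by (auto simp: d_def)
  show "\<forall>\<^sub>F x in F. norm (f x) \<le> c * norm (g x)"
    using landau_o.smallD[OF assms(1) \<open>d > 0\<close>]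
  proof eventually_elim
    case (elim x)
    have "f x \<le> d * g x + d * f x"
      using elim assms(2,3)[of x] by (simp add: algebra_simps)
    moreover have "d * f x \<le> 1/2 * f x"
      using \<open>d \<le> 1/2\<close> assms(2) by (intro mult_right_mono) auto
    ultimately have "f x \<le> 2 * d * g x" by simp
    also have "\<dots> \<le> c * g x"
      using \<open>2 * d \<le> c\<close> assms(3) by (intro mult_right_mono) auto
    finally show ?case using assms(2,3)[of x] by simp
  qed
qed

lemma bigo_matrix_vector_mult:
  fixes C :: "real^'a^'b"
  assumes "(\<lambda>z. norm (b z)) \<in> O[F](h)"
  shows "(\<lambda>z. norm (C *v b z)) \<in> O[F](h)"
proof -
  obtain c where "\<And>y. norm (C *v y) \<le> norm y * c"
    using bounded_linear.bounded[OF matrix_vector_mul_bounded_linear[of C]] by blast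
  then have "(\<lambda>z. norm (C *v b z)) \<in> O[F](\<lambda>z. norm (b z))"
    by (intro bigoI[of _ c]) (simp add: mult.commute)
  from this assms show ?thesis by (rule landau_o.big_trans)
qed

lemma smallo_bilinear:
  fixes C :: "real^'a^'b"
  assumes "(\<lambda>z. norm (a z)) \<in> o[F](g)" and "(\<lambda>z. norm (b z)) \<in> O[F](h)"
  shows "(\<lambda>z. a z \<bullet> (C *v b z)) \<in> o[F](\<lambda>z. g z * h z)"
proof -
  have "(\<lambda>z. a z \<bullet> (C *v b z)) \<in> O[F](\<lambda>z. norm (a z) * norm (C *v b z))"
    by (intro bigoI[of _ 1]) (simp add: Cauchy_Schwarz_ineq2)
  moreover have "(\<lambda>z. norm (a z) * norm (C *v b z)) \<in> o[F](\<lambda>z. g z * h z)"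
    using assms(1) bigo_matrix_vector_mult[OF assms(2)] by (rule landau_o.small_big_mult)
  ultimately show ?thesis by (rule landau_o.big_small_trans)
qed

lemma smallo_along_graph:
  fixes E :: "(real^'n) \<times> (real^'m) \<Rightarrow> real" and x :: "'z \<Rightarrow> real^'n"
  assumes E: "E \<in> o[nhds 0](\<lambda>z. (norm z)\<^sup>2)"
    and "(x \<longlongrightarrow> 0) F" and "(u \<longlongrightarrow> 0) F"
  shows "(\<lambda>z. E (x z, u z)) \<in> o[F](\<lambda>z. (norm (x z))\<^sup>2 + (norm (u z))\<^sup>2)"
proof -
  have "((\<lambda>z. (x z, u z)) \<longlongrightarrow> 0) F"
    unfolding zero_prod_def by (intro tendsto_Pair assms)
  from landau_o.small.compose[OF E this] show ?thesis
    by (simp add: norm_Pair)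
qed

section \<open>Positive definite matrices and completing the square\<close>

lemma pos_def_inner_commute:
  assumes "pos_def P"
  shows "x \<bullet> (P *v y) = y \<bullet> (P *v x)"
  using assms unfolding pos_def_def by (metis dot_lmul_matrix inner_commute transpose_matrix_vector)

text \<open>By homogeneity, \<open>c\<close> can be the minimum of the quadratic form on the compact unit sphere.\<close>

lemma pos_def_coercive:
  fixes H :: "real^'m^'m"
  assumes "pos_def H"
  obtains c where "c > 0" and "\<And>x. x \<bullet> (H *v x) \<ge> c * (norm x)\<^sup>2"
proof -
  let ?S = "sphere (0 :: real^'m) 1"
  have "\<exists>y\<in>?S. \<forall>x\<in>?S. y \<bullet> (H *v y) \<le> x \<bullet> (H *v x)"
    by (intro continuous_attains_inf continuous_intros
          linear_continuous_on matrix_vector_mul_bounded_linear) auto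
  then obtain y where y: "norm y = 1" and min: "\<And>x. norm x = 1 \<Longrightarrow> y \<bullet> (H *v y) \<le> x \<bullet> (H *v x)"
    by auto
  show thesis
  proof
    from y have "y \<noteq> 0" by auto
    then show "y \<bullet> (H *v y) > 0" using assms by (simp add: pos_def_def)
    fix x :: "real^'m"
    show "y \<bullet> (H *v y) * (norm x)\<^sup>2 \<le> x \<bullet> (H *v x)"
    proof (cases "x = 0")
      case False
      have "y \<bullet> (H *v y) \<le> (x /\<^sub>R norm x) \<bullet> (H *v (x /\<^sub>R norm x))"
        using False by (intro min) simp
      also have "\<dots> = (x \<bullet> (H *v x)) / (norm x)\<^sup>2"
        by (simp add: matrix_vector_mult_scaleR power2_eq_square divide_inverse)
      finally show ?thesis using False by (simp add: field_simps)
    qed simp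
  qed
qed

lemma pos_def_invertible:
  fixes H :: "real^'m^'m"
  assumes "pos_def H"
  shows "invertible H"
proof -
  have "\<forall>x. H *v x = 0 \<longrightarrow> x = 0"
    using assms by (metis inner_zero_right less_irrefl pos_def_def)
  then show ?thesis
    by (simp add: invertible_left_inverse matrix_left_invertible_ker)
qed

text \<open>The algebra behind the Riccati recursion. With \<open>G = B\<^sup>T P A + M\<^sup>T\<close> the terms that involve \<open>u\<close> are
  \<open>u\<^sup>T H u + 2 u\<^sup>T G x\<close>. The gain \<open>K\<close> is the solution of \<open>H K = - G\<close>, so these terms equal
  \<open>(u - K x)\<^sup>T H (u - K x) - x\<^sup>T K\<^sup>T H K x = (u - K x)\<^sup>T H (u - K x) + x\<^sup>T G\<^sup>T K x\<close>, and \<open>G\<^sup>T K\<close> is the last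
  summand of the recursion.\<close>

lemma completion_of_square:
  fixes A Q P :: "real^'n^'n" and B M :: "real^'m^'n" and R :: "real^'m^'m"
  defines "H \<equiv> R + transpose B ** P ** B"
    and "G \<equiv> transpose B ** P ** A + transpose M"
  defines "K \<equiv> - (matrix_inv H ** G)"
  assumes P: "pos_def P" and H: "pos_def H"
  shows "(A *v x + B *v u) \<bullet> (P *v (A *v x + B *v u)) + block_form Q M R x u
    = x \<bullet> ((transpose A ** P ** A + Q + (transpose A ** P ** B + M) ** K) *v x)
      + (u - K *v x) \<bullet> (H *v (u - K *v x))"
proof -
  have tr: "v \<bullet> (transpose C *v w) = (C *v v) \<bullet> w" for C :: "real^'i^'j" and v w
    by (metis dot_lmul_matrix transpose_matrix_vector transpose_transpose inner_commute)
  have neg: "(- C) *v w = - (C *v w)" for C :: "real^'i^'j" and w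
    by (metis diff_0 matrix_vector_mult_0 matrix_vector_mult_diff_rdistrib)
  have "H ** matrix_inv H = mat 1"
    using pos_def_invertible[OF H] unfolding invertible_def matrix_inv_def by (metis (mono_tags, lifting) someI_ex)
  then have HK: "H *v (K *v x) = - (G *v x)"
    by (simp add: K_def neg vec.neg matrix_vector_mul_assoc matrix_mul_assoc)
  have GK: "x \<bullet> ((transpose A ** P ** B + M) *v w) = w \<bullet> (G *v x)" for w
    using pos_def_inner_commute[OF P, of "B *v w" "A *v x"]
    by (simp add: G_def matrix_vector_mult_add_rdistrib inner_add matrix_vector_mul_assoc[symmetric] tr
        del: transpose_matrix_vector)
       (metis inner_commute)
  have "(u - K *v x) \<bullet> (H *v (u - K *v x))
      = u \<bullet> (H *v u) + 2 * (u \<bullet> (G *v x)) - (K *v x) \<bullet> (G *v x)"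
    using pos_def_inner_commute[OF H, of "K *v x" u]
    by (simp add: matrix_vector_mult_diff_distrib inner_add inner_diff HK)
  moreover have "u \<bullet> (H *v u) = u \<bullet> (R *v u) + (B *v u) \<bullet> (P *v (B *v u))"
    by (simp add: H_def matrix_vector_mult_add_rdistrib inner_add matrix_vector_mul_assoc[symmetric] tr
        del: transpose_matrix_vector)
  moreover have "u \<bullet> (G *v x) = (B *v u) \<bullet> (P *v (A *v x)) + u \<bullet> (transpose M *v x)"
    by (simp add: G_def matrix_vector_mult_add_rdistrib inner_add matrix_vector_mul_assoc[symmetric] tr
        del: transpose_matrix_vector)
  moreover have "x \<bullet> (M *v u) = u \<bullet> (transpose M *v x)"
    by (simp add: tr inner_commute del: transpose_matrix_vector)
  moreover have "x \<bullet> ((transpose A ** P ** A + Q + (transpose A ** P ** B + M) ** K) *v x)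
      = (A *v x) \<bullet> (P *v (A *v x)) + x \<bullet> (Q *v x) + (K *v x) \<bullet> (G *v x)"
    using GK[of "K *v x"]
    by (simp add: matrix_vector_mult_add_rdistrib inner_add matrix_vector_mul_assoc[symmetric] tr
        del: transpose_matrix_vector)
  ultimately show ?thesis
    using pos_def_inner_commute[OF P, of "B *v u" "A *v x"]
    by (simp add: block_form_def matrix_vector_right_distrib inner_add)
qed

section \<open>Second-order expansion of the cost of a single stage\<close>

text \<open>With \<open>l = A x + B u\<close>, the difference of \<open>f\<^sup>T P f\<close> and \<open>l\<^sup>T P l\<close> is
  \<open>(f - l)\<^sup>T P (f + l)\<close>, a product of an \<open>o(|z|)\<close> and an \<open>O(|z|)\<close> term with \<open>z = (x, u)\<close>.
  The error of the expansion of \<open>V\<close> is \<open>o(|f|\<^sup>2)\<close>, which is \<open>o(|z|\<^sup>2)\<close> because \<open>f = O(|z|)\<close>.\<close>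

lemma stage_cost_expansion:
  fixes f :: "(real^'n) \<times> (real^'m) \<Rightarrow> real^'n"
  assumes P: "pos_def P"
    and V: "(\<lambda>x. V x - 1/2 * (x \<bullet> (P *v x))) \<in> o[nhds 0](\<lambda>x. (norm x)\<^sup>2)"
    and f: "(\<lambda>(x, u). norm (f (x, u) - (A *v x + B *v u))) \<in> o[nhds 0](\<lambda>z. norm z)"
    and L: "(\<lambda>(x, u). L (x, u) - 1/2 * block_form Q M R x u) \<in> o[nhds 0](\<lambda>z. (norm z)\<^sup>2)"
    and f_cont: "continuous_on UNIV f" and f0: "f 0 = 0"
  shows "(\<lambda>(x, u). V (f (x, u)) + L (x, u)
            - 1/2 * ((A *v x + B *v u) \<bullet> (P *v (A *v x + B *v u)) + block_form Q M R x u))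
          \<in> o[nhds 0](\<lambda>z. (norm z)\<^sup>2)"
proof -
  define l where "l = (\<lambda>z::(real^'n) \<times> (real^'m). A *v fst z + B *v snd z)"
  have f': "(\<lambda>z. norm (f z - l z)) \<in> o[nhds 0](\<lambda>z. norm z)"
    using f by (simp add: l_def split_def)
  have sum_bigo: "(\<lambda>z. norm (a z + b z)) \<in> O[nhds 0](\<lambda>z. norm z)"
    if "(\<lambda>z. norm (a z)) \<in> O[nhds 0](\<lambda>z. norm z)" "(\<lambda>z. norm (b z)) \<in> O[nhds 0](\<lambda>z. norm z)"
    for a b :: "(real^'n) \<times> (real^'m) \<Rightarrow> real^'n"
  proof -
    have "(\<lambda>z. norm (a z + b z)) \<in> O[nhds 0](\<lambda>z. norm (a z) + norm (b z))"
      by (intro bigoI[of _ 1]) (simp add: norm_triangle_ineq)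
    with sum_in_bigo(1)[OF that] show ?thesis by (metis (no_types) landau_o.big_trans)
  qed
  have "(\<lambda>z::(real^'n) \<times> (real^'m). norm (fst z)) \<in> O[nhds 0](\<lambda>z. norm z)"
       "(\<lambda>z::(real^'n) \<times> (real^'m). norm (snd z)) \<in> O[nhds 0](\<lambda>z. norm z)"
    by (auto intro!: bigoI[of _ 1] always_eventually norm_fst_le norm_snd_le)
  then have l: "(\<lambda>z. norm (l z)) \<in> O[nhds 0](\<lambda>z. norm z)"
    unfolding l_def by (intro sum_bigo bigo_matrix_vector_mult)
  have fO: "(\<lambda>z. norm (f z)) \<in> O[nhds 0](\<lambda>z. norm z)"
    using sum_bigo[OF landau_o.small_imp_big[OF f'] l] by simp
  have "filterlim f (nhds 0) (nhds 0)"
    using isCont_tendsto_nhds[where f = f and a = 0] f_cont f0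
    by (simp add: continuous_on_eq_continuous_at del: split_paired_All)
  then have "(\<lambda>z. V (f z) - 1/2 * (f z \<bullet> (P *v f z))) \<in> o[nhds 0](\<lambda>z. (norm (f z))\<^sup>2)"
    by (rule landau_o.small.compose[OF V])
  moreover have "(\<lambda>z. (norm (f z))\<^sup>2) \<in> O[nhds 0](\<lambda>z. (norm z)\<^sup>2)"
    using fO by (rule landau_o.big_power)
  ultimately have Vf: "(\<lambda>z. V (f z) - 1/2 * (f z \<bullet> (P *v f z))) \<in> o[nhds 0](\<lambda>z. (norm z)\<^sup>2)"
    by (rule landau_o.small_big_trans)
  have "(\<lambda>z. (f z - l z) \<bullet> (P *v (f z + l z))) \<in> o[nhds 0](\<lambda>z. norm z * norm z)"
    by (intro smallo_bilinear f' sum_bigo fO l)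
  then have fl: "(\<lambda>z. 1/2 * ((f z - l z) \<bullet> (P *v (f z + l z)))) \<in> o[nhds 0](\<lambda>z. (norm z)\<^sup>2)"
    by (simp add: power2_eq_square)
  have eq: "f z \<bullet> (P *v f z) = l z \<bullet> (P *v l z) + (f z - l z) \<bullet> (P *v (f z + l z))" for z
    using pos_def_inner_commute[OF P, of "f z" "l z"]
    by (simp add: matrix_vector_right_distrib inner_add inner_diff)
  have L': "(\<lambda>z. L z - 1/2 * block_form Q M R (fst z) (snd z)) \<in> o[nhds 0](\<lambda>z. (norm z)\<^sup>2)"
    using L by (simp add: split_def)
  have decomp: "V (f z) + L z - 1/2 * (l z \<bullet> (P *v l z) + block_form Q M R (fst z) (snd z))
      = V (f z) - 1/2 * (f z \<bullet> (P *v f z)) + 1/2 * ((f z - l z) \<bullet> (P *v (f z + l z)))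
        + (L z - 1/2 * block_form Q M R (fst z) (snd z))" for z
    using eq[of z] by argo
  have "(\<lambda>z. V (f z) + L z - 1/2 * (l z \<bullet> (P *v l z) + block_form Q M R (fst z) (snd z)))
      \<in> o[nhds 0](\<lambda>z. (norm z)\<^sup>2)"
    unfolding decomp by (intro sum_in_smallo(1) Vf fl L')
  then show ?thesis by (simp add: split_def l_def)
qed

section \<open>Locating the minimizer\<close>

text \<open>An upper bound \<open>\<alpha>(|\<kappa>|) \<le> c\<close> with \<open>c \<rightarrow> 0\<close> is what minimality provides before anything is known about
  the size of the minimizer.\<close>

lemma class_Kinf_bound_tendsto_0:
  fixes \<kappa> :: "'x \<Rightarrow> 'u::real_normed_vector"
  assumes alpha: "class_Kinf \<alpha>"
    and le: "\<And>x. \<alpha> (norm (\<kappa> x)) \<le> c x"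
    and c: "(c \<longlongrightarrow> 0) F"
  shows "(\<kappa> \<longlongrightarrow> 0) F"
proof (rule tendstoI)
  fix e :: real assume "e > 0"
  have mono: "strict_mono_on {0..} \<alpha>" and "\<alpha> 0 = 0" using alpha by (auto simp: class_Kinf_def)
  then have "\<alpha> e > 0" using \<open>e > 0\<close> strict_mono_onD[OF mono, of 0 e] by simp
  with c have "\<forall>\<^sub>F x in F. c x < \<alpha> e" by (auto dest: order_tendstoD)
  then show "\<forall>\<^sub>F x in F. dist (\<kappa> x) 0 < e"
  proof eventually_elim
    case (elim x)
    then have "\<alpha> (norm (\<kappa> x)) < \<alpha> e" using le[of x] by simp
    then show ?case
      using strict_mono_on_less[OF mono, of "norm (\<kappa> x)" e] \<open>e > 0\<close> by simp
  qed
qed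

text \<open>Both conclusions come from comparing \<open>\<kappa> x\<close> with the competitor \<open>K *v x\<close>. The first one is
  needed for the second: the expansion \<open>E\<close> says something about \<open>F (x, \<kappa> x)\<close> only once \<open>\<kappa> x\<close> is known to be
  small.\<close>

lemma minimizer_expansion:
  fixes F :: "(real^'n) \<times> (real^'m) \<Rightarrow> real"
  assumes H: "pos_def H"
    and E: "(\<lambda>(x, u). F (x, u) - 1/2 * (x \<bullet> (P *v x) + (u - K *v x) \<bullet> (H *v (u - K *v x))))
              \<in> o[nhds 0](\<lambda>z. (norm z)\<^sup>2)"
    and alpha: "class_Kinf \<alpha>" and lower: "\<And>x u. \<alpha> (norm u) \<le> F (x, u)"
    and min: "\<And>x u. F (x, \<kappa> x) \<le> F (x, u)"
  shows "(\<kappa> \<longlongrightarrow> 0) (nhds 0)"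
    and "(\<lambda>x. norm (\<kappa> x - K *v x)) \<in> o[nhds 0](\<lambda>x. norm x)"
proof -
  define r where "r = (\<lambda>z. F z - 1/2 * (fst z \<bullet> (P *v fst z)
    + (snd z - K *v fst z) \<bullet> (H *v (snd z - K *v fst z))))"
  define w where "w = (\<lambda>x. \<kappa> x - K *v x)"
  have r: "r \<in> o[nhds 0](\<lambda>z. (norm z)\<^sup>2)" using E by (simp add: r_def split_def)
  have id0: "((\<lambda>x. x) \<longlongrightarrow> 0) (nhds (0::real^'n))" by (simp add: filterlim_ident)
  have mv0: "((\<lambda>x. C *v x) \<longlongrightarrow> 0) (nhds (0::real^'n))" for C :: "real^'n^'k"
    using isCont_tendsto_nhds[OF linear_continuous_at[OF matrix_vector_mul_bounded_linear[of C]], of 0]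
    by simp
  have KO: "(\<lambda>x. norm (K *v x)) \<in> O[nhds 0](\<lambda>x. norm x)"
    by (intro bigo_matrix_vector_mult) simp
  have "(\<lambda>x. (norm x)\<^sup>2 + (norm (K *v x))\<^sup>2) \<in> O[nhds 0](\<lambda>x. (norm x)\<^sup>2)"
    by (intro sum_in_bigo landau_o.big_power KO) simp_all
  with smallo_along_graph[OF r id0 mv0]
  have rK: "(\<lambda>x. r (x, K *v x)) \<in> o[nhds 0](\<lambda>x. (norm x)\<^sup>2)"
    by (rule landau_o.small_big_trans)
  have norm0: "((\<lambda>x. (norm x)\<^sup>2) \<longlongrightarrow> 0) (nhds (0::real^'n))"
    using tendsto_power[OF tendsto_norm_zero[OF id0], of 2] by simp
  have "(\<lambda>x. (norm x)\<^sup>2) \<in> O[nhds (0::real^'n)](\<lambda>_. 1)"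
    by (intro landau_o.small_imp_big smalloI_tendsto) (use norm0 in auto)
  with rK have "(\<lambda>x. r (x, K *v x)) \<in> o[nhds 0](\<lambda>_. 1)"
    by (rule landau_o.small_big_trans)
  then have "((\<lambda>x. r (x, K *v x)) \<longlongrightarrow> 0) (nhds 0)"
    using smalloD_tendsto by fastforce
  moreover have "((\<lambda>x. 1/2 * (x \<bullet> (P *v x))) \<longlongrightarrow> 0) (nhds 0)"
    using tendsto_mult_left[OF tendsto_inner[OF id0 mv0[of P]], of "1/2"] by simp
  ultimately have "((\<lambda>x. r (x, K *v x) + 1/2 * (x \<bullet> (P *v x))) \<longlongrightarrow> 0 + 0) (nhds 0)"
    by (rule tendsto_add)
  then have F0: "((\<lambda>x. F (x, K *v x)) \<longlongrightarrow> 0) (nhds 0)" by (simp add: r_def)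
  have "\<alpha> (norm (\<kappa> x)) \<le> F (x, K *v x)" for x
    using lower min order_trans by blast
  then show \<kappa>0: "(\<kappa> \<longlongrightarrow> 0) (nhds 0)"
    by (rule class_Kinf_bound_tendsto_0[OF alpha _ F0])
  obtain c where c: "c > 0" "\<And>x. c * (norm x)\<^sup>2 \<le> x \<bullet> (H *v x)"
    using pos_def_coercive[OF H] by blast
  \<comment> \<open>The \<open>P\<close>-terms of the two expansions cancel, and the square vanishes at \<open>K *v x\<close>.\<close>
  have sq: "c/2 * (norm (w x))\<^sup>2 \<le> r (x, K *v x) - r (x, \<kappa> x)" for x
    using min[of x "K *v x"] c(2)[of "w x"] by (simp add: r_def w_def field_simps)
  have "(\<lambda>x. (norm (w x))\<^sup>2) \<in> O[nhds 0](\<lambda>x. r (x, K *v x) - r (x, \<kappa> x))"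
  proof (intro bigoI[of _ "2/c"] always_eventually allI)
    fix x
    have "(norm (w x))\<^sup>2 \<le> 2/c * (r (x, K *v x) - r (x, \<kappa> x))"
      using sq[of x] \<open>c > 0\<close> by (simp add: field_simps)
    also have "\<dots> \<le> 2/c * \<bar>r (x, K *v x) - r (x, \<kappa> x)\<bar>"
      using \<open>c > 0\<close> by (intro mult_left_mono) auto
    finally show "norm ((norm (w x))\<^sup>2) \<le> 2/c * norm (r (x, K *v x) - r (x, \<kappa> x))" by simp
  qed
  moreover have "(\<lambda>x. r (x, K *v x) - r (x, \<kappa> x)) \<in> o[nhds 0](\<lambda>x. (norm x)\<^sup>2 + (norm (w x))\<^sup>2)"
  proof (intro sum_in_smallo)
    have "(\<lambda>x. (norm x)\<^sup>2) \<in> O[nhds 0](\<lambda>x. (norm x)\<^sup>2 + (norm (w x))\<^sup>2)"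
      by (intro bigoI[of _ 1]) simp
    then show "(\<lambda>x. r (x, K *v x)) \<in> o[nhds 0](\<lambda>x. (norm x)\<^sup>2 + (norm (w x))\<^sup>2)"
      by (rule landau_o.small_big_trans[OF rK])
    obtain C where C: "\<And>x. norm (K *v x) \<le> norm x * C"
      using bounded_linear.bounded[OF matrix_vector_mul_bounded_linear[of K]] by blast
    have "(\<lambda>x. (norm x)\<^sup>2 + (norm (\<kappa> x))\<^sup>2) \<in> O[nhds 0](\<lambda>x. (norm x)\<^sup>2 + (norm (w x))\<^sup>2)"
      \<comment> \<open>\<open>|\<kappa>|\<^sup>2 \<le> 2 |w|\<^sup>2 + 2 C\<^sup>2 |x|\<^sup>2\<close>; the constant \<open>3 + 2 C\<^sup>2\<close> dominates both coefficients of the sum.\<close>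
    proof (intro bigoI[of _ "3 + 2 * C\<^sup>2"] always_eventually allI)
      fix x
      have "norm (\<kappa> x) \<le> norm (w x) + norm x * C"
        using norm_triangle_ineq[of "w x" "K *v x"] C[of x] by (simp add: w_def)
      then have "(norm (\<kappa> x))\<^sup>2 \<le> (norm (w x) + norm x * C)\<^sup>2"
        by (intro power_mono) auto
      also have "\<dots> \<le> 2 * (norm (w x))\<^sup>2 + 2 * (norm x)\<^sup>2 * C\<^sup>2"
        using zero_le_power2[of "norm (w x) - norm x * C"]
        by (simp add: power2_sum power2_diff power_mult_distrib mult.commute)
      finally have "(norm (\<kappa> x))\<^sup>2 \<le> 2 * (norm (w x))\<^sup>2 + 2 * (norm x)\<^sup>2 * C\<^sup>2" .
      moreover have "0 \<le> C\<^sup>2 * (norm (w x))\<^sup>2" "0 \<le> (norm (w x))\<^sup>2" "0 \<le> (norm x)\<^sup>2" by simp_all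
      ultimately have "(norm x)\<^sup>2 + (norm (\<kappa> x))\<^sup>2 \<le> (3 + 2 * C\<^sup>2) * ((norm x)\<^sup>2 + (norm (w x))\<^sup>2)"
        by (simp only: algebra_simps)
      then show "norm ((norm x)\<^sup>2 + (norm (\<kappa> x))\<^sup>2)
          \<le> (3 + 2 * C\<^sup>2) * norm ((norm x)\<^sup>2 + (norm (w x))\<^sup>2)" by simp
    qed
    then show "(\<lambda>x. r (x, \<kappa> x)) \<in> o[nhds 0](\<lambda>x. (norm x)\<^sup>2 + (norm (w x))\<^sup>2)"
      by (rule landau_o.small_big_trans[OF smallo_along_graph[OF r id0 \<kappa>0]])
  qed
  ultimately have "(\<lambda>x. (norm (w x))\<^sup>2) \<in> o[nhds 0](\<lambda>x. (norm x)\<^sup>2 + (norm (w x))\<^sup>2)"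
    by (rule landau_o.big_small_trans)
  then have w2: "(\<lambda>x. (norm (w x))\<^sup>2) \<in> o[nhds 0](\<lambda>x. (norm x)\<^sup>2)"
    by (rule smallo_self_absorb) simp_all
  have "(\<lambda>x. norm (w x)) \<in> o[nhds 0](\<lambda>x. norm x)"
  proof (rule landau_o.smallI)
    fix e :: real assume "e > 0"
    then have "\<forall>\<^sub>F x in nhds 0. norm ((norm (w x))\<^sup>2) \<le> e\<^sup>2 * norm ((norm x)\<^sup>2)"
      by (intro landau_o.smallD[OF w2]) simp
    then show "\<forall>\<^sub>F x in nhds 0. norm (norm (w x)) \<le> e * norm (norm x)"
      using \<open>e > 0\<close> by (elim eventually_mono)
        (auto simp flip: power_mult_distrib intro: power2_le_imp_le)
  qed
  then show "(\<lambda>x. norm (\<kappa> x - K *v x)) \<in> o[nhds 0](\<lambda>x. norm x)" by (simp add: w_def)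
qed

text \<open>With \<open>w = \<kappa> x - K *v x\<close>, the square \<open>(w + v)\<^sup>T H (w + v)\<close> exceeds \<open>v\<^sup>T H v\<close> by
  \<open>w\<^sup>T H (w + 2 v)\<close>, which is of the form \<open>o(|x|) O(|(x, v)|)\<close>. So, up to \<open>o(|(x, v)|\<^sup>2)\<close>, the minimizer may be treated as if it
  were the linear feedback \<open>K\<close>.\<close>

lemma perturbed_minimizer_expansion:
  fixes F :: "(real^'n) \<times> (real^'m) \<Rightarrow> real"
  assumes H: "pos_def H"
    and E: "(\<lambda>(x, u). F (x, u) - 1/2 * (x \<bullet> (P *v x) + (u - K *v x) \<bullet> (H *v (u - K *v x))))
              \<in> o[nhds 0](\<lambda>z. (norm z)\<^sup>2)"
    and \<kappa>0: "(\<kappa> \<longlongrightarrow> 0) (nhds 0)"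
    and w: "(\<lambda>x. norm (\<kappa> x - K *v x)) \<in> o[nhds 0](\<lambda>x. norm x)"
  shows "(\<lambda>(x, v). F (x, \<kappa> x + v) - 1/2 * (x \<bullet> (P *v x)) - 1/2 * (v \<bullet> (H *v v)))
            \<in> o[nhds 0](\<lambda>z. (norm z)\<^sup>2)"
proof -
  define r where "r = (\<lambda>z. F z - 1/2 * (fst z \<bullet> (P *v fst z)
    + (snd z - K *v fst z) \<bullet> (H *v (snd z - K *v fst z))))"
  define w' where "w' = (\<lambda>z::(real^'n) \<times> (real^'m). \<kappa> (fst z) - K *v fst z)"
  have r: "r \<in> o[nhds 0](\<lambda>z. (norm z)\<^sup>2)" using E by (simp add: r_def split_def)
  have fst0: "(fst \<longlongrightarrow> 0) (nhds (0::(real^'n) \<times> (real^'m)))"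
   and snd0: "(snd \<longlongrightarrow> 0) (nhds (0::(real^'n) \<times> (real^'m)))"
    using tendsto_fst[OF filterlim_ident, of "0::(real^'n) \<times> (real^'m)"]
      tendsto_snd[OF filterlim_ident, of "0::(real^'n) \<times> (real^'m)"] by simp_all
  have fstO: "(\<lambda>z::(real^'n) \<times> (real^'m). norm (fst z)) \<in> O[nhds 0](\<lambda>z. norm z)"
   and sndO: "(\<lambda>z::(real^'n) \<times> (real^'m). norm (snd z)) \<in> O[nhds 0](\<lambda>z. norm z)"
    by (auto intro!: bigoI[of _ 1] always_eventually norm_fst_le norm_snd_le)
  have w'o: "(\<lambda>z. norm (w' z)) \<in> o[nhds 0](\<lambda>z. norm z)"
    unfolding w'_def by (rule landau_o.small_big_trans[OF landau_o.small.compose[OF w fst0] fstO])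
  have "(\<lambda>z. norm (\<kappa> (fst z) + snd z)) \<in> O[nhds 0](\<lambda>z::(real^'n) \<times> (real^'m). norm z)"
  proof -
    have "(\<lambda>z. norm (\<kappa> (fst z) + snd z))
        \<in> O[nhds 0](\<lambda>z::(real^'n) \<times> (real^'m). norm (w' z) + norm (K *v fst z) + norm (snd z))"
    proof (intro bigoI[of _ 1] always_eventually allI)
      fix z :: "(real^'n) \<times> (real^'m)"
      show "norm (norm (\<kappa> (fst z) + snd z)) \<le> 1 * norm (norm (w' z) + norm (K *v fst z) + norm (snd z))"
        using norm_triangle_ineq[of "w' z" "K *v fst z"]
          norm_triangle_ineq[of "w' z + K *v fst z" "snd z"]
        by (simp add: w'_def)
    qed
    moreover have "(\<lambda>z. norm (w' z) + norm (K *v fst z) + norm (snd z)) \<in> O[nhds 0](\<lambda>z. norm z)"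
      by (intro sum_in_bigo landau_o.small_imp_big[OF w'o] bigo_matrix_vector_mult fstO sndO)
    ultimately show ?thesis by (rule landau_o.big_trans)
  qed
  then have "(\<lambda>z::(real^'n) \<times> (real^'m). (norm (fst z))\<^sup>2 + (norm (\<kappa> (fst z) + snd z))\<^sup>2)
      \<in> O[nhds 0](\<lambda>z. (norm z)\<^sup>2)"
    by (intro sum_in_bigo landau_o.big_power fstO)
  moreover have "((\<lambda>z::(real^'n) \<times> (real^'m). \<kappa> (fst z) + snd z) \<longlongrightarrow> 0) (nhds 0)"
    using tendsto_add[OF filterlim_compose[OF \<kappa>0 fst0] snd0] by simp
  ultimately have r': "(\<lambda>z. r (fst z, \<kappa> (fst z) + snd z)) \<in> o[nhds 0](\<lambda>z. (norm z)\<^sup>2)"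
    by (metis (no_types) landau_o.small_big_trans smallo_along_graph[OF r fst0])
  have "(\<lambda>z. norm (w' z + 2 *\<^sub>R snd z)) \<in> O[nhds 0](\<lambda>z. norm z)"
  proof -
    have "(\<lambda>z. norm (w' z + 2 *\<^sub>R snd z)) \<in> O[nhds 0](\<lambda>z. norm (w' z) + 2 * norm (snd z))"
      by (intro bigoI[of _ 1] always_eventually allI)
         (use norm_triangle_ineq[of "w' _" "2 *\<^sub>R snd _"] in simp)
    moreover have "(\<lambda>z. norm (w' z) + 2 * norm (snd z)) \<in> O[nhds 0](\<lambda>z. norm z)"
      by (intro sum_in_bigo landau_o.small_imp_big[OF w'o]) (simp add: sndO)
    ultimately show ?thesis by (rule landau_o.big_trans)
  qed
  from smallo_bilinear[OF w'o this, of H]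
  have cross: "(\<lambda>z. 1/2 * (w' z \<bullet> (H *v (w' z + 2 *\<^sub>R snd z)))) \<in> o[nhds 0](\<lambda>z. (norm z)\<^sup>2)"
    by (simp add: power2_eq_square)
  have eq: "(w' z + snd z) \<bullet> (H *v (w' z + snd z))
      = snd z \<bullet> (H *v snd z) + w' z \<bullet> (H *v (w' z + 2 *\<^sub>R snd z))" for z
    using pos_def_inner_commute[OF H, of "snd z" "w' z"]
    by (simp add: matrix_vector_right_distrib matrix_vector_mult_scaleR inner_add)
  have "F (fst z, \<kappa> (fst z) + snd z) - 1/2 * (fst z \<bullet> (P *v fst z)) - 1/2 * (snd z \<bullet> (H *v snd z))
      = r (fst z, \<kappa> (fst z) + snd z) + 1/2 * (w' z \<bullet> (H *v (w' z + 2 *\<^sub>R snd z)))" for z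
  proof -
    have "\<kappa> (fst z) + snd z - K *v fst z = w' z + snd z" by (simp add: w'_def)
    then show ?thesis by (simp only: r_def fst_conv snd_conv eq) (simp add: algebra_simps)
  qed
  with sum_in_smallo(1)[OF r' cross] show ?thesis by (simp add: split_def)
qed

section \<open>Backward induction over the stages\<close>

text \<open>The existence of a minimizing feedback makes the \<open>LEAST\<close> in the definition of the value function an
  attained minimum.\<close>

lemma value_fn_minimizer:
  assumes "minimizing_feedback N f L Vf \<kappa>" and "k < N"
  shows "value_fn N f L Vf k x
          = value_fn N f L Vf (k + 1) (f k (x, \<kappa> k x)) + L k (x, \<kappa> k x)"
    and "value_fn N f L Vf k x \<le> value_fn N f L Vf (k + 1) (f k (x, u)) + L k (x, u)"
proof -
  let ?J = "\<lambda>u. value_fn N f L Vf (k + 1) (f k (x, u)) + L k (x, u)"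
  have min: "?J (\<kappa> k x) \<le> ?J u" for u
    using assms by (simp add: minimizing_feedback_def is_arg_min_linorder del: add_Suc_right One_nat_def)
  have "value_fn N f L Vf k x = (LEAST c. c \<in> range ?J)"
    using assms(2) by (subst value_fn.simps) simp
  also have "\<dots> = ?J (\<kappa> k x)"
    by (rule Least_equality) (auto intro: min[simplified])
  finally show "value_fn N f L Vf k x = ?J (\<kappa> k x)" .
  with min show "value_fn N f L Vf k x \<le> ?J u" by simp
qed

theorem lemma2:
  fixes N :: nat
    and f :: "nat \<Rightarrow> (real^'n) \<times> (real^'m) \<Rightarrow> real^'n"
    and L :: "nat \<Rightarrow> (real^'n) \<times> (real^'m) \<Rightarrow> real"
    and Vf :: "real^'n \<Rightarrow> real"
    and \<alpha> :: "real \<Rightarrow> real"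
    and \<kappa> :: "nat \<Rightarrow> real^'n \<Rightarrow> real^'m"
    and A Q :: "nat \<Rightarrow> real^'n^'n"
    and B M :: "nat \<Rightarrow> real^'m^'n"
    and R :: "nat \<Rightarrow> real^'m^'m"
    and Pf :: "real^'n^'n"
    and P :: "nat \<Rightarrow> real^'n^'n"
    and K :: "nat \<Rightarrow> real^'n^'m"
  assumes N_pos: "N > 0"
    and f_cont: "\<forall>k<N. continuous_on UNIV (f k)"
    and f_zero: "\<forall>k<N. f k (0, 0) = 0"
    and L_cont: "\<forall>k<N. continuous_on UNIV (L k) \<and> locally_bounded (L k)"
    and Vf_cont: "continuous_on UNIV Vf \<and> locally_bounded Vf"
    and L_zero: "\<forall>k<N. L k (0, 0) = 0"
    and Vf_zero: "Vf 0 = 0"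
    and alpha: "class_Kinf \<alpha>"
    and L_lower: "\<forall>k<N. \<forall>x u. L k (x, u) \<ge> \<alpha> (norm u)"
    and Vf_nonneg: "\<forall>x. Vf x \<ge> 0"
    and feedback: "minimizing_feedback N f L Vf \<kappa>"
    and f_expansion: "\<forall>k<N. (\<lambda>(x, u). norm (f k (x, u) - (A k *v x + B k *v u)))
                            \<in> o[at (0, 0)](\<lambda>(x, u). norm (x, u))"
    and L_expansion: "\<forall>k<N. (\<lambda>(x, u). L k (x, u) - 1/2 * block_form (Q k) (M k) (R k) x u)
                            \<in> o[at (0, 0)](\<lambda>(x, u). (norm (x, u))^2)"
    and Vf_expansion: "(\<lambda>x. Vf x - 1/2 * (x \<bullet> (Pf *v x))) \<in> o[at 0](\<lambda>x. (norm x)^2)"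
    and P_final: "P N = Pf"
    and K_eq: "\<forall>k<N. K k = - (matrix_inv (R k + transpose (B k) ** P (k + 1) ** B k)
                              ** (transpose (B k) ** P (k + 1) ** A k + transpose (M k)))"
    and P_eq: "\<forall>k<N. P k = transpose (A k) ** P (k + 1) ** A k + Q k
                            + (transpose (A k) ** P (k + 1) ** B k + M k) ** K k"
    and Pf_pos_def: "pos_def Pf"
    and P_pos_def: "\<forall>k<N. pos_def (P k)"
    and H_pos_def: "\<forall>k<N. pos_def (R k + transpose (B k) ** P (k + 1) ** B k)"
  shows "\<forall>k<N. (\<lambda>(x, v). delta_value N f L Vf \<kappa> k (x, v)
                   - 1/2 * (v \<bullet> ((R k + transpose (B k) ** P (k + 1) ** B k) *v v)))
                 \<in> o[at (0, 0)](\<lambda>(x, v). (norm (x, v))^2)"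
proof -
  let ?V = "value_fn N f L Vf"
  let ?H = "\<lambda>k. R k + transpose (B k) ** P (k + 1) ** B k"
  let ?F = "\<lambda>k (x, u). ?V (k + 1) (f k (x, u)) + L k (x, u)"
  let ?quad = "\<lambda>k. (\<lambda>x. ?V k x - 1/2 * (x \<bullet> (P k *v x))) \<in> o[nhds 0](\<lambda>x. (norm x)\<^sup>2)"
  have P_pos: "pos_def (P k)" if "k \<le> N" for k
    using that P_pos_def Pf_pos_def P_final by (cases "k = N") auto
  have \<alpha>_nonneg: "\<alpha> (norm u) \<ge> 0" for u :: "real^'m"
    using alpha by (simp add: class_Kinf_def image_subset_iff)

  \<comment> \<open>One step of the backward induction, together with the expansion of the shifted cost.
    Nonnegativity is carried along because it gives \<open>\<alpha>(|u|) \<le> F(x, u)\<close>.\<close>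
  have stage: "(\<forall>x. ?V k x \<ge> 0) \<and> ?quad k
      \<and> (\<lambda>(x, v). ?F k (x, \<kappa> k x + v) - 1/2 * (x \<bullet> (P k *v x)) - 1/2 * (v \<bullet> (?H k *v v)))
            \<in> o[nhds 0](\<lambda>z. (norm z)\<^sup>2)"
    if k: "k < N" and nonneg: "\<forall>x. ?V (k + 1) x \<ge> 0"
      and quad: "?quad (k + 1)" for k
  proof -
    note val = value_fn_minimizer[OF feedback k]
    have f0: "f k 0 = 0" using f_zero k by (simp add: zero_prod_def)
    have F_lower: "\<alpha> (norm u) \<le> ?F k (x, u)" for x u
      using nonneg L_lower k by (smt (verit) case_prod_conv)
    have nonneg_k: "\<forall>x. ?V k x \<ge> 0"
      using val(1) F_lower \<alpha>_nonneg by (metis (no_types, lifting) case_prod_conv order_trans)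
    have f: "(\<lambda>(x, u). norm (f k (x, u) - (A k *v x + B k *v u))) \<in> o[nhds 0](\<lambda>z. norm z)"
      using f_expansion f_zero k unfolding zero_prod_def
      by (intro smallo_at_imp_nhds) (simp_all add: split_def)
    have L: "(\<lambda>(x, u). L k (x, u) - 1/2 * block_form (Q k) (M k) (R k) x u)
        \<in> o[nhds 0](\<lambda>z. (norm z)\<^sup>2)"
      using L_expansion L_zero k unfolding zero_prod_def
      by (intro smallo_at_imp_nhds) (simp_all add: split_def block_form_def)
    have PN: "pos_def (P (k + 1))" using k by (intro P_pos) simp
    have H: "pos_def (?H k)" using H_pos_def k by simp
    have "(A k *v x + B k *v u) \<bullet> (P (k + 1) *v (A k *v x + B k *v u))
          + block_form (Q k) (M k) (R k) x u
        = x \<bullet> (P k *v x) + (u - K k *v x) \<bullet> (?H k *v (u - K k *v x))" for x u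
      using completion_of_square[OF PN H, where A = "A k" and Q = "Q k" and M = "M k"] K_eq P_eq k
      by metis
    then have E: "(\<lambda>(x, u). ?F k (x, u)
        - 1/2 * (x \<bullet> (P k *v x) + (u - K k *v x) \<bullet> (?H k *v (u - K k *v x))))
          \<in> o[nhds 0](\<lambda>z. (norm z)\<^sup>2)"
      using stage_cost_expansion[OF PN quad f L _ f0] f_cont k by simp
    have min: "?F k (x, \<kappa> k x) \<le> ?F k (x, u)" for x u
      using val[of x] by simp
    note w = minimizer_expansion[OF H E alpha F_lower min]
    note delta = perturbed_minimizer_expansion[OF H E w]
    \<comment> \<open>At \<open>v = 0\<close> the shifted cost is the value function.\<close>
    have "((\<lambda>x. (x, 0)) \<longlongrightarrow> (0 :: (real^'n) \<times> (real^'m))) (nhds 0)"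
      unfolding zero_prod_def by (intro tendsto_Pair filterlim_ident tendsto_const)
    from landau_o.small.compose[OF delta this] have "?quad k"
      using val(1) by (simp add: norm_Pair)
    with nonneg_k delta show ?thesis by simp
  qed

  have V_expansion: "(\<forall>x. ?V k x \<ge> 0) \<and> ?quad k" if "k \<le> N" for k
    using that
  proof (induction k rule: inc_induct)
    case base
    have "?V N = Vf" by (rule ext) (simp add: value_fn.simps)
    moreover have "(\<lambda>x. Vf x - 1/2 * (x \<bullet> (Pf *v x))) \<in> o[nhds 0](\<lambda>x. (norm x)\<^sup>2)"
      using Vf_expansion Vf_zero by (intro smallo_at_imp_nhds) simp_all
    ultimately show ?case using Vf_nonneg Vf_zero P_final by simp
  next
    case (step k)
    then show ?case using stage[of k] by simp
  qed

  show ?thesis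
  proof (intro allI impI)
    fix k assume k: "k < N"
    have quad: "?quad k" using V_expansion[of k] k by simp
    have delta: "(\<lambda>(x, v). ?F k (x, \<kappa> k x + v) - 1/2 * (x \<bullet> (P k *v x)) - 1/2 * (v \<bullet> (?H k *v v)))
        \<in> o[nhds 0](\<lambda>z. (norm z)\<^sup>2)"
      using stage[OF k] V_expansion[of "k + 1"] k by simp
    have fst0: "(fst \<longlongrightarrow> 0) (nhds (0::(real^'n) \<times> (real^'m)))"
      using tendsto_fst[OF filterlim_ident, of "0::(real^'n) \<times> (real^'m)"] by simp
    have "(\<lambda>z::(real^'n) \<times> (real^'m). (norm (fst z))\<^sup>2) \<in> O[nhds 0](\<lambda>z. (norm z)\<^sup>2)"
      by (intro landau_o.big_power bigoI[of _ 1] always_eventually) (auto intro: norm_fst_le)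
    with landau_o.small.compose[OF quad fst0]
    have "(\<lambda>z::(real^'n) \<times> (real^'m). ?V k (fst z) - 1/2 * (fst z \<bullet> (P k *v fst z)))
        \<in> o[nhds 0](\<lambda>z. (norm z)\<^sup>2)"
      by (rule landau_o.small_big_trans)
    from sum_in_smallo(2)[OF delta this]
    have "(\<lambda>(x, v). delta_value N f L Vf \<kappa> k (x, v) - 1/2 * (v \<bullet> (?H k *v v)))
        \<in> o[nhds 0](\<lambda>z. (norm z)\<^sup>2)"
      by (simp add: split_def delta_value_def shift_input_def algebra_simps)
    then show "(\<lambda>(x, v). delta_value N f L Vf \<kappa> k (x, v) - 1/2 * (v \<bullet> (?H k *v v)))
        \<in> o[at (0, 0)](\<lambda>(x, v). (norm (x, v))\<^sup>2)"
      by (intro smallo_nhds_imp_at) (simp add: zero_prod_def split_def)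
  qed
qed

end
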